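(* Let $(X,d)$ be a metric space such that $d$ is not bounded. Let $\mathcal{I}$ and $\mathcal{K}$ be two ideals on a set $S$ such that $\mathcal{K}\subseteq\mathcal{I}$ and there exists at least one $\mathcal{K}$-divergent function from $S$ to $X$. If for every function $g\colon S\to X$, $\mathcal{I}$-divergence of $g$ implies $\mathcal{I}^{\mathcal{K}}$-divergence of $g$, then the condition $\mathrm{AP}(\mathcal{I},\mathcal{K})$ holds.
   Context: An ideal on a set $S$ is a nonempty family of subsets of $S$ closed under subsets and finite unions (not required to be proper). Its dual filter is $\mathcal{F}(\mathcal{I})=\{S\setminus A: A\in\mathcal{I}\}$. For $M\subseteq S$, $\mathcal{K}|_M=\{A\cap M: A\in\mathcal{K}\}$ is the trace ideal on $M$. Let $(X,d)$ be a metric space. A function $f\colon S\to X$ is $\mathcal{I}$-divergent if there is $x\in X$ such that for every $r>0$, $\{k\in S: d(f(k),x)\le r\}\in\mathcal{I}$. It is $\mathcal{I}^{\mathcal{K}}$-divergent if there is $M\in\mathcal{F}(\mathcal{I})$ such that $f|_M\colon M\to X$ is $\mathcal{K}|_M$-divergent. Condition $\mathrm{AP}(\mathcal{I},\mathcal{K})$: for every sequence $(A_n)_{n\in\mathbb{N}}$ of pairwise disjoint sets $A_n\in\mathcal{I}$ there exists a sequence $(B_n)_{n\in\mathbb{N}}$ of sets $B_n\in\mathcal{I}$ such that $A_n\triangle B_n\in\mathcal{K}$ for each $n$ and $\bigcup_{n\in\mathbb{N}}B_n\in\mathcal{I}$. *)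

theory Defs
  imports "HOL-Analysis.Analysis"
begin

text \<open>Ideals need not be proper: \<^term>\<open>Pow S\<close> is allowed.\<close>

definition set_ideal :: "'a set \<Rightarrow> 'a set set \<Rightarrow> bool" where
  "set_ideal S \<I> \<longleftrightarrow>
     \<I> \<subseteq> Pow S \<and> \<I> \<noteq> {} \<and>
     (\<forall>A\<in>\<I>. \<forall>B. B \<subseteq> A \<longrightarrow> B \<in> \<I>) \<and>
     (\<forall>A\<in>\<I>. \<forall>B\<in>\<I>. A \<union> B \<in> \<I>)"

definition dual_filter :: "'a set \<Rightarrow> 'a set set \<Rightarrow> 'a set set" where
  "dual_filter S \<I> = {S - A | A. A \<in> \<I>}"

definition trace_ideal :: "'a set set \<Rightarrow> 'a set \<Rightarrow> 'a set set" where
  "trace_ideal \<K> M = {A \<inter> M | A. A \<in> \<K>}"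

text \<open>In the next two definitions \<open>X\<close> and \<open>d\<close> are the carrier and the distance of a metric
  space, \<open>S\<close> is the domain of \<open>f\<close>, and \<open>f \<in> S \<rightarrow> X\<close> is to be assumed where they are used.\<close>

definition ideal_divergent ::
    "'b set \<Rightarrow> ('b \<Rightarrow> 'b \<Rightarrow> real) \<Rightarrow> 'a set \<Rightarrow> 'a set set \<Rightarrow> ('a \<Rightarrow> 'b) \<Rightarrow> bool" where
  "ideal_divergent X d S \<I> f \<longleftrightarrow> (\<exists>x\<in>X. \<forall>r>0. {k\<in>S. d (f k) x \<le> r} \<in> \<I>)"

definition ideal2_divergent ::
    "'b set \<Rightarrow> ('b \<Rightarrow> 'b \<Rightarrow> real) \<Rightarrow> 'a set \<Rightarrow> 'a set set \<Rightarrow> 'a set set \<Rightarrow> ('a \<Rightarrow> 'b) \<Rightarrow> bool" where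
  "ideal2_divergent X d S \<I> \<K> f \<longleftrightarrow>
     (\<exists>M\<in>dual_filter S \<I>. ideal_divergent X d M (trace_ideal \<K> M) (restrict f M))"

definition AP :: "'a set set \<Rightarrow> 'a set set \<Rightarrow> bool" where
  "AP \<I> \<K> \<longleftrightarrow>
     (\<forall>A :: nat \<Rightarrow> 'a set. (\<forall>n. A n \<in> \<I>) \<and> disjoint_family A \<longrightarrow>
        (\<exists>B :: nat \<Rightarrow> 'a set. (\<forall>n. B n \<in> \<I>) \<and> (\<forall>n. sym_diff (A n) (B n) \<in> \<K>) \<and>
           (\<Union>n. B n) \<in> \<I>))"

end

theory Submission
  imports Defs
begin

text \<open>
  A sequence \<open>A n\<close> of disjoint members of \<open>\<I>\<close> is coded into a single \<open>\<I>\<close>-divergent function.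
  Since \<open>d\<close> is unbounded, there are points \<open>y n\<close> escaping to infinity; let \<open>g\<close> take the constant
  value \<open>y n\<close> on \<open>A n\<close>, and agree with a fixed \<open>\<K>\<close>-divergent function elsewhere. A ball meets
  only finitely many of the values \<open>y n\<close>, so its preimage under \<open>g\<close> is covered by a set in
  \<open>\<K> \<subseteq> \<I>\<close> and finitely many \<open>A n\<close>: thus \<open>g\<close> is \<open>\<I>\<close>-divergent (\<open>ideal_divergent_override\<close>).

  By hypothesis there is then \<open>C \<in> \<I>\<close> such that \<open>g\<close> is \<open>\<K>\<close>-divergent off \<open>C\<close>. As \<open>g\<close> is
  constant on \<open>A n\<close>, a single ball contains the whole image of \<open>A n\<close>, which forces
  \<open>A n - C \<in> \<K>\<close> (\<open>ideal2_divergent_bounded_pieces\<close>). Hence the sets \<open>B n = A n \<inter> C\<close> differ from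
  \<open>A n\<close> by members of \<open>\<K>\<close>, and their union is in \<open>\<I>\<close> because it is contained in \<open>C\<close>.
\<close>

lemma set_ideal_carrier: "set_ideal S \<I> \<Longrightarrow> A \<in> \<I> \<Longrightarrow> A \<subseteq> S"
  unfolding set_ideal_def by (simp add: subset_iff)

lemma set_ideal_subset: "set_ideal S \<I> \<Longrightarrow> A \<in> \<I> \<Longrightarrow> B \<subseteq> A \<Longrightarrow> B \<in> \<I>"
  unfolding set_ideal_def by blast

lemma set_ideal_Un: "set_ideal S \<I> \<Longrightarrow> A \<in> \<I> \<Longrightarrow> B \<in> \<I> \<Longrightarrow> A \<union> B \<in> \<I>"
  unfolding set_ideal_def by blast

lemma set_ideal_UN:
  assumes "set_ideal S \<I>" "finite N" "\<And>n. n \<in> N \<Longrightarrow> A n \<in> \<I>"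
  shows "(\<Union>n\<in>N. A n) \<in> \<I>"
  using assms(2,3)
proof (induction N rule: finite_induct)
  case empty
  from assms(1) have "\<I> \<noteq> {}"
    unfolding set_ideal_def by simp
  then obtain E where "E \<in> \<I>"
    by blast
  then show ?case
    using set_ideal_subset[OF assms(1)] by auto
next
  case (insert n N)
  then show ?case
    using set_ideal_Un[OF assms(1)] by simp
qed

lemma (in Metric_space) unbounded_obtains_escaping:
  assumes "\<not> mbounded M" and "x \<in> M"
  obtains y :: "nat \<Rightarrow> 'a" where "\<And>n. y n \<in> M" "\<And>n. d (y n) x > real n"
proof -
  have "\<exists>y\<in>M. d y x > real n" for n
  proof (rule ccontr)
    assume "\<not> ?thesis"
    then have "M \<subseteq> mcball x (real n)"
      using \<open>x \<in> M\<close> by (auto simp: commute not_less)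
    with assms(1) show False
      unfolding mbounded_def by blast
  qed
  then show thesis
    using that by metis
qed

text \<open>
  The points where the new function stays in the ball of radius \<open>r\<close> lie either in the
  corresponding set for \<open>f\<close>, or in some \<open>A n\<close> with \<open>n < r\<close>, of which there are finitely many.
\<close>

lemma ideal_divergent_override:
  fixes y :: "nat \<Rightarrow> 'b"
  assumes \<I>: "set_ideal S \<I>" and "x \<in> X"
    and A: "\<And>n. A n \<in> \<I>"
    and f: "\<And>r. r > 0 \<Longrightarrow> {k\<in>S. d (f k) x \<le> r} \<in> \<I>"
    and y: "\<And>n. d (y n) x > real n"
    and g_on: "\<And>k n. k \<in> A n \<Longrightarrow> g k = y n"
    and g_off: "\<And>k. k \<notin> (\<Union>n. A n) \<Longrightarrow> g k = f k"
  shows "ideal_divergent X d S \<I> g"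
  unfolding ideal_divergent_def
proof (intro bexI[OF _ \<open>x \<in> X\<close>] allI impI)
  fix r :: real
  assume "r > 0"
  let ?N = "{..nat \<lceil>r\<rceil>}"
  have "{k\<in>S. d (g k) x \<le> r} \<subseteq> {k\<in>S. d (f k) x \<le> r} \<union> (\<Union>n\<in>?N. A n)"
  proof
    fix k
    assume k: "k \<in> {k\<in>S. d (g k) x \<le> r}"
    show "k \<in> {k\<in>S. d (f k) x \<le> r} \<union> (\<Union>n\<in>?N. A n)"
    proof (cases "k \<in> (\<Union>n. A n)")
      case True
      then obtain n where n: "k \<in> A n" by blast
      with k y[of n] g_on have "real n < r" by fastforce
      then have "n \<in> ?N" by simp linarith
      with n show ?thesis by blast
    next
      case False
      with k g_off show ?thesis by simp
    qed
  qed
  moreover have "{k\<in>S. d (f k) x \<le> r} \<union> (\<Union>n\<in>?N. A n) \<in> \<I>"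
    by (intro set_ideal_Un[OF \<I>] set_ideal_UN[OF \<I>] f \<open>r > 0\<close> A) simp
  ultimately show "{k\<in>S. d (g k) x \<le> r} \<in> \<I>"
    using set_ideal_subset[OF \<I>] by blast
qed

text \<open>
  The exceptional set \<open>C\<close> is chosen before the pieces \<open>P\<close>, so that it serves all of them at once.
  Boundedness is asked for around every centre because the centre witnessing the divergence
  of \<open>g\<close> off \<open>C\<close> is not under control.
\<close>

lemma ideal2_divergent_bounded_pieces:
  assumes \<K>: "set_ideal S \<K>" and g: "ideal2_divergent X d S \<I> \<K> g"
  obtains C where "C \<in> \<I>"
    "\<And>P. P \<subseteq> S \<Longrightarrow> (\<And>x. x \<in> X \<Longrightarrow> \<exists>r>0. \<forall>k\<in>P. d (g k) x \<le> r) \<Longrightarrow> P - C \<in> \<K>"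
proof -
  from g obtain C x where C: "C \<in> \<I>" and "x \<in> X"
    and div: "\<And>r. r > 0 \<Longrightarrow>
      {k\<in>S - C. d (restrict g (S - C) k) x \<le> r} \<in> trace_ideal \<K> (S - C)"
    unfolding ideal2_divergent_def ideal_divergent_def dual_filter_def by blast
  have trace: "trace_ideal \<K> (S - C) \<subseteq> \<K>"
    unfolding trace_ideal_def using set_ideal_subset[OF \<K>] by blast
  have "P - C \<in> \<K>"
    if P: "P \<subseteq> S" "\<And>x. x \<in> X \<Longrightarrow> \<exists>r>0. \<forall>k\<in>P. d (g k) x \<le> r" for P
  proof -
    from P(2)[OF \<open>x \<in> X\<close>] obtain r where "r > 0" and r: "\<forall>k\<in>P. d (g k) x \<le> r"
      by blast
    have "{k\<in>S - C. d (restrict g (S - C) k) x \<le> r} \<in> \<K>"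
      using div[OF \<open>r > 0\<close>] trace by blast
    moreover have "P - C \<subseteq> {k\<in>S - C. d (restrict g (S - C) k) x \<le> r}"
      using P(1) r by auto
    ultimately show ?thesis
      using set_ideal_subset[OF \<K>] by blast
  qed
  with C that show thesis by blast
qed

theorem theorem6p10:
  fixes X :: "'b set" and d :: "'b \<Rightarrow> 'b \<Rightarrow> real"
    and S :: "'a set" and \<I> \<K> :: "'a set set"
  assumes "Metric_space X d"
    and "\<not> Metric_space.mbounded X d X"
    and "set_ideal S \<I>" and "set_ideal S \<K>"
    and "\<K> \<subseteq> \<I>"
    and "\<exists>f\<in>S \<rightarrow> X. ideal_divergent X d S \<K> f"
    and "\<And>g. g \<in> S \<rightarrow> X \<Longrightarrow> ideal_divergent X d S \<I> g \<Longrightarrow> ideal2_divergent X d S \<I> \<K> g"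
  shows "AP \<I> \<K>"
  unfolding AP_def
proof (intro allI impI)
  fix A :: "nat \<Rightarrow> 'a set"
  assume "(\<forall>n. A n \<in> \<I>) \<and> disjoint_family A"
  then have A: "\<And>n. A n \<in> \<I>" and disj: "disjoint_family A" by auto
  from assms(6) obtain f x where f: "f \<in> S \<rightarrow> X" and "x \<in> X"
    and f_div: "\<And>r. r > 0 \<Longrightarrow> {k\<in>S. d (f k) x \<le> r} \<in> \<K>"
    unfolding ideal_divergent_def by blast
  obtain y :: "nat \<Rightarrow> 'b" where yX: "\<And>n. y n \<in> X" and y: "\<And>n. d (y n) x > real n"
    using Metric_space.unbounded_obtains_escaping[OF assms(1,2) \<open>x \<in> X\<close>] by blast
  define g where "g k = (if k \<in> (\<Union>n. A n) then y (SOME n. k \<in> A n) else f k)" for k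
  have g_on: "g k = y n" if "k \<in> A n" for k n
  proof -
    have "k \<in> A (SOME n. k \<in> A n)"
      using that by (rule someI)
    with that disj have "(SOME n. k \<in> A n) = n"
      unfolding disjoint_family_on_def by blast
    with that show ?thesis
      unfolding g_def by auto
  qed
  have "g \<in> S \<rightarrow> X"
    using f yX unfolding g_def by auto
  moreover have "ideal_divergent X d S \<I> g"
  proof (rule ideal_divergent_override[where A = A, OF assms(3) \<open>x \<in> X\<close> A])
    show "{k\<in>S. d (f k) x \<le> r} \<in> \<I>" if "r > 0" for r
      using f_div[OF that] assms(5) by blast
    show "g k = f k" if "k \<notin> (\<Union>n. A n)" for k
      using that unfolding g_def by simp
  qed (fact y g_on)+
  ultimately have "ideal2_divergent X d S \<I> \<K> g"
    by (rule assms(7))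
  then obtain C where C: "C \<in> \<I>"
    and pieces: "\<And>P. P \<subseteq> S \<Longrightarrow> (\<And>x. x \<in> X \<Longrightarrow> \<exists>r>0. \<forall>k\<in>P. d (g k) x \<le> r) \<Longrightarrow> P - C \<in> \<K>"
    using ideal2_divergent_bounded_pieces[OF assms(4)] by blast
  have diff: "A n - C \<in> \<K>" for n
  proof (rule pieces)
    show "A n \<subseteq> S"
      using set_ideal_carrier[OF assms(3) A] .
    show "\<exists>r>0. \<forall>k\<in>A n. d (g k) z \<le> r" for z
      \<comment> \<open>the distance itself may be \<open>0\<close>, and the radius must be positive\<close>
      by (rule exI[of _ "max 1 (d (y n) z)"]) (auto simp: g_on)
  qed
  show "\<exists>B. (\<forall>n. B n \<in> \<I>) \<and> (\<forall>n. sym_diff (A n) (B n) \<in> \<K>) \<and> (\<Union>n. B n) \<in> \<I>"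
  proof (intro exI[of _ "\<lambda>n. A n \<inter> C"] conjI allI)
    show "A n \<inter> C \<in> \<I>" for n
      by (rule set_ideal_subset[OF assms(3) C]) blast
    have "sym_diff (A n) (A n \<inter> C) = A n - C" for n
      by blast
    then show "sym_diff (A n) (A n \<inter> C) \<in> \<K>" for n
      using diff by simp
    show "(\<Union>n. A n \<inter> C) \<in> \<I>"
      by (rule set_ideal_subset[OF assms(3) C]) blast
  qed
qed

end
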